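(* Let $G_3(x,y,z)=\sum_{k,\ell,m\ge 0}V(1^k2^\ell3^m)\,x^ky^\ell z^m$ be the ordinary generating function of the numbers of vertices of the Gelfand--Zetlin polytopes $GZ(1^k2^\ell3^m)$. Then $$G_3(x,y,z)=\frac{2xz-y(1-x-z)-y\sqrt{1-2(x+z)+(x-z)^2}}{2(1-x-z)\bigl((x+y)(y+z)-y\bigr)}.$$
   Context: Let $\lambda_1\le\dots\le\lambda_n$ be a non-decreasing finite sequence of integers (called a partition). The Gelfand--Zetlin polytope $GZ(\lambda)$ is the convex polytope in $\mathbb{R}^{n(n-1)/2}$ with coordinates $u_{i,j}$ ($1\le i\le n-1$, $1\le j\le n-i$) defined by the inequalities $u_{i-1,j}\le u_{i,j}\le u_{i-1,j+1}$ for all such $i,j$, where $u_{0,j}:=\lambda_j$. For non-negative integers $k,\ell,m$ (some possibly zero), $1^k2^\ell3^m$ denotes the sequence consisting of $k$ copies of $1$, followed by $\ell$ copies of $2$, followed by $m$ copies of $3$. $V(p)$ denotes the number of vertices of $GZ(p)$; for the empty sequence $V=1$ (the polytope is a point). The square root denotes the formal power series in $x,z$ with constant term $1$ whose square is $1-2(x+z)+(x-z)^2$; the identity is in the field of fractions of the power series ring $\mathbb{Q}[[x,y,z]]$ (equivalently, $G_3$ times the denominator equals the numerator). *)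

theory Defs
  imports
    "HOL-Analysis.Analysis"
    "HOL-Analysis.Finite_Function_Topology"
    "HOL-Computational_Algebra.Computational_Algebra"
begin

section \<open>Gelfand--Zetlin polytopes\<close>

definition gz_index :: "nat \<Rightarrow> (nat \<times> nat) set" where
  "gz_index n = {(i, j). 1 \<le> i \<and> i \<le> n - 1 \<and> 1 \<le> j \<and> j \<le> n - i}"

text \<open>
  The dimension $n(n-1)/2$ depends on the length $n$ of the sequence, so $\mathbb{R}^{n(n-1)/2}$
  is the subspace of those finitely supported functions on pairs of naturals whose support lies
  in \<^term>\<open>gz_index n\<close>. Since $p = \lambda$ is indexed from 1 and lists from 0,
  $u_{0,j} = \lambda_j$ is read off at position \<^term>\<open>j - 1\<close>.
\<close>

definition gz_entry :: "int list \<Rightarrow> (nat \<times> nat, real) poly_mapping \<Rightarrow> nat \<Rightarrow> nat \<Rightarrow> real" where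
  "gz_entry p u i j = (if i = 0 then of_int (p ! (j - 1)) else Poly_Mapping.lookup u (i, j))"

definition GZ :: "int list \<Rightarrow> (nat \<times> nat, real) poly_mapping set" where
  "GZ p = {u. Poly_Mapping.keys u \<subseteq> gz_index (length p) \<and>
     (\<forall>(i, j) \<in> gz_index (length p).
        gz_entry p u (i - 1) j \<le> gz_entry p u i j \<and>
        gz_entry p u i j \<le> gz_entry p u (i - 1) (j + 1))}"

definition gz_vertex_count :: "int list \<Rightarrow> nat" where
  "gz_vertex_count p = card {v. v extreme_point_of GZ p}"

section \<open>Power series in three variables\<close>

text \<open>
  $\mathbb{Q}[[x,y,z]]$ is represented as $\mathbb{Q}[[z]][[y]][[x]]$: the coefficient of
  $x^k y^l z^m$ in \<open>f\<close> is \<open>f $ k $ l $ m\<close>.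
\<close>

type_synonym fps3 = "rat fps fps fps"

definition var_x :: fps3 where "var_x = fps_X"
definition var_y :: fps3 where "var_y = fps_const fps_X"
definition var_z :: fps3 where "var_z = fps_const (fps_const fps_X)"

text \<open>
  The root is unique, and it exists for every series with constant term 1. For a series in
  $x, z$ only it is again a series in $x, z$ only.
\<close>

definition fps3_sqrt :: "fps3 \<Rightarrow> fps3" where
  "fps3_sqrt f = (THE s. s ^ 2 = f \<and>
     fps_nth (fps_nth (fps_nth s 0) 0) 0 = 1)"

definition G3 :: fps3 where
  "G3 = Abs_fps (\<lambda>k. Abs_fps (\<lambda>l. Abs_fps (\<lambda>m.
     of_nat (gz_vertex_count (replicate k 1 @ replicate l 2 @ replicate m 3)))))"

end

theory Submission
  imports Defs
begin

text \<open>
  Coordinates of a vertex of $GZ(p)$ are tied to entries of $p$ by chains of equalities, since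
  a block of equal coordinates that avoids the values of $p$ can be moved both ways. So the first
  row $q$ of a vertex satisfies $q_j \in \{p_j, p_{j+1}\}$, and the other rows form a vertex of
  $GZ(q)$. For $p = 1^k 2^l 3^m$ this gives
  $V(k,l,m) = V(k-1,l,m) + V(k,l,m-1) + V(k,l-1,m) + V(k-1,l+1,m-1)$ for $l \ge 1$, while
  $V(k,0,m)$ satisfies Pascal's rule. The coefficients of $W^l/(1-x-z)$, where
  $W = 1 + (x+z)W + xzW^2$, satisfy the same recurrence, so
  $G_3 = 1/((1-x-z)(1-yW))$, and the square root is $1-x-z-2xzW$.
\<close>

unbundle no vec_syntax
unbundle fps_syntax

section \<open>Vertices by peeling off the first row\<close>

text \<open>A set, so that the two choices at equal neighbours count once.\<close>

fun first_rows :: "'a list \<Rightarrow> 'a list set" where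
  "first_rows (a # b # r) = (\<Union>q\<in>first_rows (b # r). {a # q, b # q})"
| "first_rows _ = {[]}"

lemma finite_first_rows [simp]: "finite (first_rows p)"
  by (induction p rule: first_rows.induct) auto

lemma first_rows_iff:
  "q \<in> first_rows p \<longleftrightarrow>
     length q = length p - 1 \<and> (\<forall>j<length q. q ! j = p ! j \<or> q ! j = p ! Suc j)"
proof (induction p arbitrary: q rule: first_rows.induct)
  case (1 a b r)
  show ?case
  proof (cases q)
    case (Cons c q')
    then show ?thesis
      using 1 by (auto simp: All_less_Suc2)
  qed auto
qed auto

text \<open>Neighbours in \<open>q\<close> are separated by an entry of \<open>p\<close>:
  \<open>q ! i\<close> \<le> \<open>p ! Suc i\<close> \<le> \<open>q ! Suc i\<close>. This keeps the
  recursion inside sorted lists.\<close>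

lemma sorted_first_rows:
  assumes "sorted p" "q \<in> first_rows p"
  shows "sorted q"
  unfolding sorted_iff_nth_Suc
proof (intro allI impI)
  fix i assume i: "Suc i < length q"
  then have len: "Suc (Suc i) < length p"
    using assms(2) by (simp add: first_rows_iff)
  have "p ! i \<le> p ! Suc i" "p ! Suc i \<le> p ! Suc (Suc i)"
    using assms(1) len by (auto intro: sorted_nth_mono)
  moreover have "q ! i = p ! i \<or> q ! i = p ! Suc i"
    "q ! Suc i = p ! Suc i \<or> q ! Suc i = p ! Suc (Suc i)"
    using assms(2) i by (auto simp: first_rows_iff)
  ultimately show "q ! i \<le> q ! Suc i" by auto
qed

section \<open>Finitely supported functions on the index triangle\<close>

lemma finite_gz_index: "finite (gz_index n)"
  by (rule finite_subset[of _ "{..n} \<times> {..n}"]) (auto simp: gz_index_def)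

lemma gz_index_Suc:
  "(Suc i, j) \<in> gz_index (Suc n) \<longleftrightarrow> (i, j) \<in> gz_index n \<or> (i = 0 \<and> 1 \<le> j \<and> j \<le> n)"
  by (auto simp: gz_index_def)

lemma gz_index_0: "(0, j) \<notin> gz_index n"
  by (auto simp: gz_index_def)

text \<open>Cutting off outside \<open>gz_index n\<close> makes the support finite, as
  \<open>Abs_poly_mapping\<close> requires.\<close>

definition tabulate :: "nat \<Rightarrow> (nat \<Rightarrow> nat \<Rightarrow> real) \<Rightarrow> (nat \<times> nat, real) poly_mapping" where
  "tabulate n f = Abs_poly_mapping (\<lambda>(i, j). if (i, j) \<in> gz_index n then f i j else 0)"

lemma lookup_tabulate:
  "Poly_Mapping.lookup (tabulate n f) (i, j) = (if (i, j) \<in> gz_index n then f i j else 0)"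
proof -
  have "finite {x. (case x of (i, j) \<Rightarrow> if (i, j) \<in> gz_index n then f i j else 0) \<noteq> 0}"
    by (rule finite_subset[OF _ finite_gz_index[of n]]) (auto split: if_splits)
  then show ?thesis
    by (simp add: tabulate_def)
qed

lemma keys_tabulate: "Poly_Mapping.keys (tabulate n f) \<subseteq> gz_index n"
  by (auto simp: in_keys_iff lookup_tabulate split: if_splits)

lemma lookup_scaleR_poly [simp]:
  "Poly_Mapping.lookup (c *\<^sub>R (u :: (nat \<times> nat, real) poly_mapping)) ij = c * Poly_Mapping.lookup u ij"
  by (simp add: scaleR_poly_mapping_def)

lemma lookup_outside:
  "Poly_Mapping.keys u \<subseteq> S \<Longrightarrow> ij \<notin> S \<Longrightarrow> Poly_Mapping.lookup u ij = 0"
  by (auto simp: in_keys_iff)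

text \<open>Row indices in \<open>gz_index\<close> are positive, so \<open>Suc i\<close> can replace
  \<open>i\<close> and the truncated subtraction disappears.\<close>

lemma mem_GZ_iff:
  "u \<in> GZ p \<longleftrightarrow> Poly_Mapping.keys u \<subseteq> gz_index (length p) \<and>
     (\<forall>i j. (Suc i, j) \<in> gz_index (length p) \<longrightarrow>
        gz_entry p u i j \<le> gz_entry p u (Suc i) j \<and>
        gz_entry p u (Suc i) j \<le> gz_entry p u i (Suc j))"
proof -
  have "(\<forall>(i, j) \<in> gz_index n. P i j) \<longleftrightarrow> (\<forall>i j. (Suc i, j) \<in> gz_index n \<longrightarrow> P (Suc i) j)" for n P
  proof safe
    fix i j assume "\<forall>i j. (Suc i, j) \<in> gz_index n \<longrightarrow> P (Suc i) j" "(i, j) \<in> gz_index n"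
    then show "P i j"
      by (cases i) (auto simp: gz_index_0)
  qed auto
  then show ?thesis
    by (simp add: GZ_def)
qed

lemma GZ_Nil: "GZ [] = {0}"
proof -
  have "gz_index 0 = {}"
    by (auto simp: gz_index_def)
  then show ?thesis
    by (auto simp: GZ_def)
qed

section \<open>Attaching and deleting the first row\<close>

text \<open>Since \<open>gz_entry q w 0\<close> reads off \<open>q\<close>, row 1 is
  \<open>q\<close>, and row i of \<open>w\<close> becomes row i + 1.\<close>

definition gz_cons :: "int list \<Rightarrow> (nat \<times> nat, real) poly_mapping \<Rightarrow> (nat \<times> nat, real) poly_mapping" where
  "gz_cons q w = tabulate (Suc (length q)) (\<lambda>i. gz_entry q w (i - 1))"

definition gz_tail :: "nat \<Rightarrow> (nat \<times> nat, real) poly_mapping \<Rightarrow> (nat \<times> nat, real) poly_mapping" where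
  "gz_tail n v = tabulate n (\<lambda>i j. Poly_Mapping.lookup v (Suc i, j))"

lemma gz_entry_gz_cons:
  "(Suc i, j) \<in> gz_index (Suc (length q)) \<Longrightarrow> gz_entry p (gz_cons q w) (Suc i) j = gz_entry q w i j"
  by (simp add: gz_entry_def gz_cons_def lookup_tabulate)

lemma gz_tail_gz_cons:
  assumes "Poly_Mapping.keys w \<subseteq> gz_index (length q)"
  shows "gz_tail (length q) (gz_cons q w) = w"
proof (rule poly_mapping_eqI, clarify)
  fix i j
  show "Poly_Mapping.lookup (gz_tail (length q) (gz_cons q w)) (i, j) = Poly_Mapping.lookup w (i, j)"
    using lookup_outside[OF assms, of "(i, j)"]
    by (auto simp: gz_tail_def gz_cons_def lookup_tabulate gz_index_Suc gz_entry_def gz_index_0)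
qed

lemma gz_cons_gz_tail:
  assumes "Poly_Mapping.keys v \<subseteq> gz_index (Suc (length q))"
    and row: "\<And>j. j < length q \<Longrightarrow> Poly_Mapping.lookup v (1, Suc j) = of_int (q ! j)"
  shows "gz_cons q (gz_tail (length q) v) = v"
proof (rule poly_mapping_eqI, clarify)
  fix i j
  \<comment> \<open>Three sources of a coordinate: zero outside the index set, the list
    \<open>q\<close> in row 1, and \<open>v\<close> in later rows.\<close>
  consider "(i, j) \<notin> gz_index (Suc (length q))"
    | j' where "i = 1" "j = Suc j'" "j' < length q"
    | i' where "i = Suc i'" "i' \<noteq> 0" "(i', j) \<in> gz_index (length q)" "(i, j) \<in> gz_index (Suc (length q))"
  proof (cases "(i, j) \<in> gz_index (Suc (length q))")
    case True
    then obtain i' j' where ij: "i = Suc i'" "j = Suc j'"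
      by (cases i; cases j) (auto simp: gz_index_def)
    show ?thesis
    proof (cases "i' = 0")
      case True
      then have "j' < length q"
        using \<open>(i, j) \<in> _\<close> ij by (simp add: gz_index_def)
      then show ?thesis
        using ij True that(2) by simp
    next
      case False
      then show ?thesis
        using \<open>(i, j) \<in> _\<close> ij that(3) by (auto simp: gz_index_Suc)
    qed
  qed (rule that(1))
  then show "Poly_Mapping.lookup (gz_cons q (gz_tail (length q) v)) (i, j) = Poly_Mapping.lookup v (i, j)"
  proof cases
    case 1
    then show ?thesis
      using lookup_outside[OF assms(1) 1] by (simp add: gz_cons_def lookup_tabulate)
  next
    case 2
    then show ?thesis
      using row by (simp add: gz_cons_def lookup_tabulate gz_index_Suc gz_entry_def)
  next
    case 3
    then show ?thesis
      by (simp add: gz_cons_def lookup_tabulate gz_entry_def gz_tail_def)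
  qed
qed

text \<open>The inequalities between rows 0 and 1 become bounds on \<open>q\<close>; all others are
  those of \<open>GZ q\<close>, shifted by one row.\<close>

lemma gz_cons_mem_GZ_iff:
  assumes p: "length p = Suc (length q)" and w: "Poly_Mapping.keys w \<subseteq> gz_index (length q)"
  shows "gz_cons q w \<in> GZ p \<longleftrightarrow>
    (\<forall>j<length q. p ! j \<le> q ! j \<and> q ! j \<le> p ! Suc j) \<and> w \<in> GZ q"
proof -
  let ?n = "length q" and ?v = "gz_cons q w"
  let ?P = "\<lambda>i j. gz_entry p ?v i j \<le> gz_entry p ?v (Suc i) j \<and>
        gz_entry p ?v (Suc i) j \<le> gz_entry p ?v i (Suc j)"
  have "?v \<in> GZ p \<longleftrightarrow> (\<forall>i j. (Suc i, j) \<in> gz_index (Suc ?n) \<longrightarrow> ?P i j)"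
    unfolding mem_GZ_iff p by (simp add: gz_cons_def keys_tabulate)
  also have "\<dots> \<longleftrightarrow> (\<forall>j<?n. ?P 0 (Suc j)) \<and> (\<forall>i j. (Suc i, j) \<in> gz_index ?n \<longrightarrow> ?P (Suc i) j)"
    (is "?L \<longleftrightarrow> ?A \<and> ?B")
  proof
    assume ?L then show "?A \<and> ?B"
      by (simp add: gz_index_Suc)
  next
    assume R: "?A \<and> ?B"
    show ?L
    proof (intro allI impI)
      fix i j assume ij: "(Suc i, j) \<in> gz_index (Suc ?n)"
      show "?P i j"
        by (cases i; cases j) (use ij R in \<open>auto simp: gz_index_Suc gz_index_0 gz_index_def\<close>)
    qed
  qed
  also have "?A \<longleftrightarrow> (\<forall>j<?n. p ! j \<le> q ! j \<and> q ! j \<le> p ! Suc j)"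
  proof -
    have "gz_entry p ?v 0 (Suc j) = p ! j" for j
      by (simp add: gz_entry_def)
    moreover have "gz_entry p ?v (Suc 0) (Suc j) = q ! j" if "j < ?n" for j
      using that by (subst gz_entry_gz_cons) (simp_all add: gz_index_Suc gz_entry_def)
    ultimately show ?thesis by simp
  qed
  also have "?B \<longleftrightarrow> w \<in> GZ q"
  proof -
    have "?P (Suc i) j \<longleftrightarrow> gz_entry q w i j \<le> gz_entry q w (Suc i) j \<and>
        gz_entry q w (Suc i) j \<le> gz_entry q w i (Suc j)"
      if "(Suc i, j) \<in> gz_index ?n" for i j
    proof -
      have "(Suc (Suc i), j) \<in> gz_index (Suc ?n)" "(Suc i, j) \<in> gz_index (Suc ?n)"
        "(Suc i, Suc j) \<in> gz_index (Suc ?n)"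
        using that by (auto simp: gz_index_def)
      then show ?thesis
        by (simp add: gz_entry_gz_cons)
    qed
    then show ?thesis
      unfolding mem_GZ_iff using w by auto
  qed
  finally show ?thesis .
qed

text \<open>Row 1 is the constant \<open>q\<close>, so the map is affine but in general not linear:
  the coefficients must add up to 1.\<close>

lemma gz_cons_affine:
  "gz_cons q ((1 - t) *\<^sub>R a + t *\<^sub>R b) = (1 - t) *\<^sub>R gz_cons q a + t *\<^sub>R gz_cons q b"
  by (rule poly_mapping_eqI)
    (auto simp: gz_cons_def lookup_tabulate lookup_add gz_entry_def simp flip: distrib_right)

lemma gz_tail_affine:
  "gz_tail n ((1 - t) *\<^sub>R a + t *\<^sub>R b) = (1 - t) *\<^sub>R gz_tail n a + t *\<^sub>R gz_tail n b"
  by (rule poly_mapping_eqI)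
    (auto simp: gz_tail_def lookup_tabulate lookup_add)

lemma keys_gz_tail: "Poly_Mapping.keys (gz_tail n v) \<subseteq> gz_index n"
  by (simp add: gz_tail_def keys_tabulate)

lemma keys_GZ: "u \<in> GZ p \<Longrightarrow> Poly_Mapping.keys u \<subseteq> gz_index (length p)"
  by (simp add: mem_GZ_iff)

section \<open>Extreme points and their first rows\<close>

lemma first_row_bounds:
  assumes "u \<in> GZ p" and "Suc j < length p"
  shows "of_int (p ! j) \<le> Poly_Mapping.lookup u (1, Suc j)"
    and "Poly_Mapping.lookup u (1, Suc j) \<le> of_int (p ! Suc j)"
proof -
  have "(Suc 0, Suc j) \<in> gz_index (length p)"
    using assms(2) by (auto simp: gz_index_def)
  then have "gz_entry p u 0 (Suc j) \<le> gz_entry p u (Suc 0) (Suc j) \<and>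
      gz_entry p u (Suc 0) (Suc j) \<le> gz_entry p u 0 (Suc (Suc j))"
    using assms(1) unfolding mem_GZ_iff by blast
  then show "of_int (p ! j) \<le> Poly_Mapping.lookup u (1, Suc j)"
    and "Poly_Mapping.lookup u (1, Suc j) \<le> of_int (p ! Suc j)"
    by (simp_all add: gz_entry_def)
qed

text \<open>Ends of an interval are extreme: measured from an end, \<open>a\<close> and
  \<open>b\<close> deviate to the same side, so with positive weights they cannot cancel.\<close>

lemma convex_comb_at_endpoint:
  fixes a b c d t :: real
  assumes "0 < t" "t < 1" "c \<le> a" "a \<le> d" "c \<le> b" "b \<le> d"
    and "x = (1 - t) * a + t * b" "x = c \<or> x = d"
  shows "a = x \<and> b = x"
proof -
  have *: "a = e \<and> b = e" if "(1 - t) * (a - e) + t * (b - e) = 0"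
    "(a \<ge> e \<and> b \<ge> e) \<or> (a \<le> e \<and> b \<le> e)" for e
  proof -
    have "(1 - t) * (a - e) = 0 \<and> t * (b - e) = 0"
    proof (cases "a \<ge> e \<and> b \<ge> e")
      case True
      then have "0 \<le> (1 - t) * (a - e)" "0 \<le> t * (b - e)"
        using assms(1,2) by auto
      then show ?thesis using that(1) by linarith
    next
      case False
      then have "(1 - t) * (a - e) \<le> 0" "t * (b - e) \<le> 0"
        using that(2) assms(1,2) by (auto simp: mult_nonneg_nonpos)
      then show ?thesis using that(1) by linarith
    qed
    then show ?thesis using assms(1,2) by auto
  qed
  show ?thesis
    using assms(3-8) by (intro *) (auto simp: algebra_simps)
qed

text \<open>On \<open>GZ q\<close>, \<open>gz_cons q\<close> is an injective affine map onto the
  slice of \<open>GZ p\<close> with first row \<open>q\<close>. The slice is a face because each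
  \<open>q ! j\<close> is an end of the interval allowed for that coordinate, so extremality passes
  both ways.\<close>

lemma gz_cons_extreme_iff:
  assumes "sorted p" and p: "length p = Suc (length q)" and q: "q \<in> first_rows p"
    and w: "Poly_Mapping.keys w \<subseteq> gz_index (length q)"
  shows "gz_cons q w extreme_point_of GZ p \<longleftrightarrow> w extreme_point_of GZ q"
proof -
  let ?n = "length q"
  have bounds: "\<forall>j<?n. p ! j \<le> q ! j \<and> q ! j \<le> p ! Suc j"
  proof (intro allI impI)
    fix j assume j: "j < ?n"
    then have "p ! j \<le> p ! Suc j"
      using p \<open>sorted p\<close> by (auto intro: sorted_nth_mono)
    then show "p ! j \<le> q ! j \<and> q ! j \<le> p ! Suc j"
      using q j by (auto simp: first_rows_iff)
  qed
  have mem: "gz_cons q u \<in> GZ p \<longleftrightarrow> u \<in> GZ q" if "Poly_Mapping.keys u \<subseteq> gz_index ?n" for u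
    using gz_cons_mem_GZ_iff[OF p that] bounds by blast
  show ?thesis
  proof
    assume ext: "gz_cons q w extreme_point_of GZ p"
    show "w extreme_point_of GZ q"
      unfolding extreme_point_of_def
    proof (intro conjI ballI notI)
      show "w \<in> GZ q"
        using ext mem[OF w] by (simp add: extreme_point_of_def)
      fix a b assume ab: "a \<in> GZ q" "b \<in> GZ q" and "w \<in> open_segment a b"
      then obtain t where t: "a \<noteq> b" "0 < t" "t < 1" "w = (1 - t) *\<^sub>R a + t *\<^sub>R b"
        by (auto simp: in_segment)
      have "gz_cons q a \<noteq> gz_cons q b"
        using t(1) gz_tail_gz_cons[OF keys_GZ] ab by metis
      then have "gz_cons q w \<in> open_segment (gz_cons q a) (gz_cons q b)"
        using t gz_cons_affine by (auto simp: in_segment)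
      moreover have "gz_cons q a \<in> GZ p" "gz_cons q b \<in> GZ p"
        using ab mem keys_GZ by auto
      ultimately show False
        using ext by (auto simp: extreme_point_of_def)
    qed
  next
    assume ext: "w extreme_point_of GZ q"
    show "gz_cons q w extreme_point_of GZ p"
      unfolding extreme_point_of_def
    proof (intro conjI ballI notI)
      show "gz_cons q w \<in> GZ p"
        using ext mem[OF w] by (simp add: extreme_point_of_def)
      fix a b assume ab: "a \<in> GZ p" "b \<in> GZ p" and "gz_cons q w \<in> open_segment a b"
      then obtain t where t: "a \<noteq> b" "0 < t" "t < 1" "gz_cons q w = (1 - t) *\<^sub>R a + t *\<^sub>R b"
        by (auto simp: in_segment)
      \<comment> \<open>Both ends of a segment through \<open>gz_cons q w\<close> must have first
        row \<open>q\<close>, and hence lie in the slice.\<close>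
      have row: "Poly_Mapping.lookup a (1, Suc j) = q ! j \<and> Poly_Mapping.lookup b (1, Suc j) = q ! j"
        if j: "j < ?n" for j
      proof (rule convex_comb_at_endpoint[OF t(2,3)])
        show "of_int (p ! j) \<le> Poly_Mapping.lookup a (1, Suc j)"
          "Poly_Mapping.lookup a (1, Suc j) \<le> of_int (p ! Suc j)"
          "of_int (p ! j) \<le> Poly_Mapping.lookup b (1, Suc j)"
          "Poly_Mapping.lookup b (1, Suc j) \<le> of_int (p ! Suc j)"
          using first_row_bounds ab j p by auto
        have "Poly_Mapping.lookup (gz_cons q w) (1, Suc j) = q ! j"
          using j by (simp add: gz_cons_def lookup_tabulate gz_index_Suc gz_entry_def)
        then show "real_of_int (q ! j) =
            (1 - t) * Poly_Mapping.lookup a (1, Suc j) + t * Poly_Mapping.lookup b (1, Suc j)"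
          unfolding t(4) by (simp add: lookup_add)
        show "real_of_int (q ! j) = of_int (p ! j) \<or> real_of_int (q ! j) = of_int (p ! Suc j)"
          using q j by (auto simp: first_rows_iff)
      qed
      have a: "gz_cons q (gz_tail ?n a) = a" and b: "gz_cons q (gz_tail ?n b) = b"
        using row keys_GZ[OF ab(1)] keys_GZ[OF ab(2)] p by (auto intro!: gz_cons_gz_tail)
      have "gz_tail ?n a \<in> GZ q" "gz_tail ?n b \<in> GZ q"
        using ab mem[OF keys_gz_tail] a b by metis+
      moreover have "w = (1 - t) *\<^sub>R gz_tail ?n a + t *\<^sub>R gz_tail ?n b"
        using gz_tail_gz_cons[OF w] unfolding t(4) gz_tail_affine by simp
      moreover have "gz_tail ?n a \<noteq> gz_tail ?n b"
        using t(1) a b by metis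
      ultimately show False
        using ext t(2,3) by (auto simp: extreme_point_of_def in_segment)
    qed
  qed
qed

text \<open>If a first-row coordinate has a value \<open>c\<close> strictly between its bounds, all
  coordinates equal to \<open>c\<close> can be moved together, slightly up or down, without leaving
  \<open>GZ p\<close>. Then \<open>v\<close> is a midpoint. Moving the whole level set avoids any
  discussion of connected blocks.\<close>

lemma extreme_first_row_entry:
  assumes "sorted p" and ext: "v extreme_point_of GZ p" and j0: "Suc j0 < length p"
  shows "Poly_Mapping.lookup v (1, Suc j0) = of_int (p ! j0) \<or>
    Poly_Mapping.lookup v (1, Suc j0) = of_int (p ! Suc j0)"
proof (rule ccontr)
  let ?n = "length p"
  define c where "c = Poly_Mapping.lookup v (1, Suc j0)"
  assume neg: "\<not> ?thesis"
  have v: "v \<in> GZ p"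
    using ext by (simp add: extreme_point_of_def)
  have c: "of_int (p ! j0) < c" "c < of_int (p ! Suc j0)"
    using neg first_row_bounds[OF v j0] by (auto simp: c_def)
  \<comment> \<open>By sortedness \<open>p\<close> has no entry strictly between
    \<open>p ! j0\<close> and \<open>p ! Suc j0\<close>, so row 0 stays fixed when the value
    \<open>c\<close> moves.\<close>
  have notin: "of_int (p ! i) \<noteq> c" if "i < ?n" for i
  proof (cases "i \<le> j0")
    case True
    then have "p ! i \<le> p ! j0"
      using assms(1) j0 by (intro sorted_nth_mono) auto
    then show ?thesis using c by linarith
  next
    case False
    then have "p ! Suc j0 \<le> p ! i"
      using assms(1) that by (intro sorted_nth_mono) auto
    then show ?thesis using c by linarith
  qed
  define F where "F = (\<lambda>(i, j). Poly_Mapping.lookup v (i, j)) ` gz_index ?n \<union> of_int ` set p"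
  have "finite F"
    by (simp add: F_def finite_gz_index)
  then obtain e where e: "e > 0" "\<And>x. x \<in> F \<Longrightarrow> x \<noteq> c \<Longrightarrow> e \<le> dist c x"
    using finite_set_avoid[of F c] by metis
  define \<phi> where "\<phi> s x = (if x = c then x + s else x)" for s x :: real
  define u where "u s = tabulate ?n (\<lambda>i j. \<phi> s (Poly_Mapping.lookup v (i, j)))" for s
  \<comment> \<open>All other values in \<open>F\<close> have distance at least \<open>e\<close>
    from \<open>c\<close>, so a shift by at most \<open>e\<close> may reach but not pass them, and
    weak inequalities survive.\<close>
  have mono: "\<phi> s x \<le> \<phi> s y" if "x \<in> F" "y \<in> F" "x \<le> y" "\<bar>s\<bar> \<le> e" for s x y
    using that e(2)[of x] e(2)[of y] by (auto simp: \<phi>_def dist_real_def)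
  have u_mem: "u s \<in> GZ p" if s: "\<bar>s\<bar> \<le> e" for s
  proof -
    have entry: "gz_entry p (u s) i j = \<phi> s (gz_entry p v i j) \<and> gz_entry p v i j \<in> F"
      if "(i, j) \<in> gz_index ?n \<or> (i = 0 \<and> 1 \<le> j \<and> j \<le> ?n)" for i j
    proof (cases "i = 0")
      case True
      then have "j - 1 < ?n"
        using that by (auto simp: gz_index_0)
      then show ?thesis
        using True notin[of "j - 1"] by (simp add: gz_entry_def \<phi>_def F_def)
    next
      case False
      then have "(i, j) \<in> gz_index ?n"
        using that by simp
      then show ?thesis
        using False by (force simp: gz_entry_def u_def lookup_tabulate F_def)
    qed
    show ?thesis
      unfolding mem_GZ_iff
    proof (intro conjI allI impI)
      show "Poly_Mapping.keys (u s) \<subseteq> gz_index ?n"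
        by (simp add: u_def keys_tabulate)
      fix i j assume ij: "(Suc i, j) \<in> gz_index ?n"
      then have nb: "(i, j) \<in> gz_index ?n \<or> (i = 0 \<and> 1 \<le> j \<and> j \<le> ?n)"
        "(i, Suc j) \<in> gz_index ?n \<or> (i = 0 \<and> 1 \<le> Suc j \<and> Suc j \<le> ?n)"
        by (auto simp: gz_index_def)
      note entry[OF nb(1)] entry[OF nb(2)] entry[OF disjI1[OF ij]]
      moreover have "gz_entry p v i j \<le> gz_entry p v (Suc i) j"
        "gz_entry p v (Suc i) j \<le> gz_entry p v i (Suc j)"
        using v ij unfolding mem_GZ_iff by blast+
      ultimately show "gz_entry p (u s) i j \<le> gz_entry p (u s) (Suc i) j"
        "gz_entry p (u s) (Suc i) j \<le> gz_entry p (u s) i (Suc j)"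
        using mono[OF _ _ _ s] by simp_all
    qed
  qed
  have idx: "(1, Suc j0) \<in> gz_index ?n"
    using j0 by (auto simp: gz_index_def)
  \<comment> \<open>Coordinates equal to \<open>c\<close> become \<open>c + e\<close> and
    \<open>c - e\<close>; all others agree in the two points.\<close>
  have "v = (1 - 1/2) *\<^sub>R u e + (1/2) *\<^sub>R u (- e)"
  proof (rule poly_mapping_eqI, clarify)
    fix i j
    show "Poly_Mapping.lookup v (i, j) =
      Poly_Mapping.lookup ((1 - 1/2) *\<^sub>R u e + (1/2) *\<^sub>R u (- e)) (i, j)"
      using lookup_outside[OF keys_GZ[OF v], of "(i, j)"]
      by (simp add: lookup_add u_def lookup_tabulate \<phi>_def field_simps)
  qed
  moreover have "u e \<noteq> u (- e)"
  proof
    assume "u e = u (- e)"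
    then have "Poly_Mapping.lookup (u e) (1, Suc j0) = Poly_Mapping.lookup (u (- e)) (1, Suc j0)"
      by simp
    then show False
      using idx e(1) by (simp add: u_def lookup_tabulate \<phi>_def c_def)
  qed
  ultimately have "v \<in> open_segment (u e) (u (- e))"
    unfolding in_segment by (intro conjI exI[of _ "1/2"]) auto
  then show False
    using ext u_mem[of e] u_mem[of "- e"] e(1) by (auto simp: extreme_point_of_def)
qed

text \<open>The first row of an extreme point lies in \<open>first_rows p\<close> by
  \<open>extreme_first_row_entry\<close>; \<open>gz_cons_extreme_iff\<close> handles the remaining
  rows.\<close>

lemma extreme_points_GZ:
  assumes "sorted p" "p \<noteq> []"
  shows "{v. v extreme_point_of GZ p} =
    (\<Union>q\<in>first_rows p. gz_cons q ` {w. w extreme_point_of GZ q})" (is "?L = ?R")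
proof
  have len: "length p = Suc (length q)" if "q \<in> first_rows p" for q
    using that assms(2) by (cases p) (auto simp: first_rows_iff)
  show "?R \<subseteq> ?L"
  proof clarify
    fix q w assume q: "q \<in> first_rows p" and w: "w extreme_point_of GZ q"
    then have "Poly_Mapping.keys w \<subseteq> gz_index (length q)"
      by (simp add: keys_GZ extreme_point_of_def)
    then show "gz_cons q w extreme_point_of GZ p"
      using gz_cons_extreme_iff[OF assms(1) len[OF q] q] w by blast
  qed
  show "?L \<subseteq> ?R"
  proof clarify
    fix v assume v: "v extreme_point_of GZ p"
    then have vm: "v \<in> GZ p"
      by (simp add: extreme_point_of_def)
    \<comment> \<open>The floor is exact: each first-row coordinate of an extreme point equals an
      entry of \<open>p\<close>.\<close>
    define q where "q = map (\<lambda>j. \<lfloor>Poly_Mapping.lookup v (1, Suc j)\<rfloor>) [0..<length p - 1]"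
    have entry: "Poly_Mapping.lookup v (1, Suc j) = of_int (q ! j) \<and> (q ! j = p ! j \<or> q ! j = p ! Suc j)"
      if "j < length p - 1" for j
    proof -
      have "Suc j < length p"
        using that by simp
      then show ?thesis
        using extreme_first_row_entry[OF assms(1) v, of j] that by (auto simp: q_def)
    qed
    have q: "q \<in> first_rows p"
      using entry by (simp add: first_rows_iff) (simp add: q_def)
    have "gz_cons q (gz_tail (length q) v) = v"
      using entry keys_GZ[OF vm] len[OF q] by (intro gz_cons_gz_tail) auto
    moreover have "gz_tail (length q) v extreme_point_of GZ q"
      using gz_cons_extreme_iff[OF assms(1) len[OF q] q keys_gz_tail, of v] calculation v by simp
    ultimately show "v \<in> ?R"
      using q by (metis (mono_tags) UN_I image_eqI mem_Collect_eq)
  qed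
qed

section \<open>Counting vertices by their first rows\<close>

text \<open>Makes the union in \<open>extreme_points_GZ\<close> disjoint and each
  \<open>gz_cons q\<close> injective there, so that cardinalities add.\<close>

lemma gz_cons_eq_iff:
  assumes "length q = length q'"
    "Poly_Mapping.keys w \<subseteq> gz_index (length q)" "Poly_Mapping.keys w' \<subseteq> gz_index (length q')"
  shows "gz_cons q w = gz_cons q' w' \<longleftrightarrow> q = q' \<and> w = w'"
proof
  assume eq: "gz_cons q w = gz_cons q' w'"
  have "q ! j = q' ! j" if "j < length q" for j
  proof -
    have "Poly_Mapping.lookup (gz_cons q w) (1, Suc j) = Poly_Mapping.lookup (gz_cons q' w') (1, Suc j)"
      by (simp add: eq)
    then show ?thesis
      using that assms(1) by (simp add: gz_cons_def lookup_tabulate gz_index_Suc gz_entry_def)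
  qed
  then have "q = q'"
    using assms(1) by (simp add: list_eq_iff_nth_eq)
  moreover have "w = w'"
    using gz_tail_gz_cons[OF assms(2)] gz_tail_gz_cons[OF assms(3)] eq assms(1) by metis
  ultimately show "q = q' \<and> w = w'" ..
qed simp

text \<open>Needed because \<open>card\<close> is 0 on infinite sets. Each step of the induction is
  a finite union of images.\<close>

lemma finite_extreme_points_GZ: "sorted p \<Longrightarrow> finite {v. v extreme_point_of GZ p}"
proof (induction "length p" arbitrary: p)
  case 0
  then show ?case by (simp add: GZ_Nil)
next
  case (Suc n)
  have "finite {w. w extreme_point_of GZ q}" if "q \<in> first_rows p" for q
  proof (rule Suc(1))
    show "n = length q"
      using that Suc(2) by (auto simp: first_rows_iff)
    show "sorted q"
      using that Suc(3) by (rule sorted_first_rows[rotated])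
  qed
  then show ?case
    using Suc extreme_points_GZ[of p] by fastforce
qed

lemma gz_vertex_count_Nil: "gz_vertex_count [] = 1"
  by (simp add: gz_vertex_count_def GZ_Nil)

lemma gz_vertex_count_rec:
  assumes "sorted p" "p \<noteq> []"
  shows "gz_vertex_count p = (\<Sum>q\<in>first_rows p. gz_vertex_count q)"
proof -
  let ?E = "\<lambda>q. {w. w extreme_point_of GZ q}"
  have keys: "Poly_Mapping.keys w \<subseteq> gz_index (length q)" if "w \<in> ?E q" for w q
    using that keys_GZ by (auto simp: extreme_point_of_def)
  have len: "length q = length q'" if "q \<in> first_rows p" "q' \<in> first_rows p" for q q'
    using that by (simp add: first_rows_iff)
  have inj: "inj_on (gz_cons q) (?E q)" for q
    by (rule inj_onI) (use gz_cons_eq_iff keys in blast)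
  have "gz_vertex_count p = (\<Sum>q\<in>first_rows p. card (gz_cons q ` ?E q))"
    unfolding gz_vertex_count_def extreme_points_GZ[OF assms]
  proof (rule card_UN_disjoint)
    show "\<forall>q\<in>first_rows p. finite (gz_cons q ` ?E q)"
      using finite_extreme_points_GZ sorted_first_rows[OF assms(1)] by blast
    show "\<forall>q\<in>first_rows p. \<forall>q'\<in>first_rows p. q \<noteq> q' \<longrightarrow> gz_cons q ` ?E q \<inter> gz_cons q' ` ?E q' = {}"
      using gz_cons_eq_iff[OF len] keys by blast
  qed simp
  then show ?thesis
    by (simp add: card_image[OF inj] gz_vertex_count_def)
qed

section \<open>The generating function\<close>


abbreviation X2 :: "rat fps fps" where "X2 \<equiv> fps_X"
abbreviation Z2 :: "rat fps fps" where "Z2 \<equiv> fps_const fps_X"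

text \<open>
  The smaller root of the kernel $y^2 - (1-x-z)y + xz$ is $xz$ times the series $W$ (\<open>narayana_fps\<close>
  below) with $W = 1 + (x+z)W + xzW^2$, and the larger one is $1/W$; the recursion compares
  coefficients of $x^n$ in this equation.
\<close>

fun narayana_coeff :: "nat \<Rightarrow> rat fps" where
  "narayana_coeff 0 = inverse (1 - fps_X)"
| "narayana_coeff (Suc n) = inverse (1 - fps_X) *
     (narayana_coeff n + fps_X * (\<Sum>i=0..n. narayana_coeff i * narayana_coeff (n - i)))"

definition narayana_fps :: "rat fps fps" where
  "narayana_fps = Abs_fps narayana_coeff"

text \<open>The series 1/(1 - x - z), expanded in powers of x.\<close>

definition geometric_fps :: "rat fps fps" where
  "geometric_fps = Abs_fps (\<lambda>k. inverse (1 - fps_X) ^ Suc k)"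

lemma inverse_one_minus_fps_X: "inverse (1 - fps_X :: rat fps) * (1 - fps_X) = 1"
  by (rule inverse_mult_eq_1) simp

text \<open>At x^0 the claim is W_0 (1 - z) = 1; at x^(k+1) it is the recursion of
  \<open>narayana_coeff\<close> multiplied by 1 - z.\<close>

lemma narayana_fps_eq: "narayana_fps * (1 - X2 - Z2) = 1 + X2 * (Z2 * narayana_fps\<^sup>2)"
proof (rule fps_ext)
  fix n
  have split: "narayana_fps * (1 - X2 - Z2) = narayana_fps - X2 * narayana_fps - Z2 * narayana_fps"
    by (simp add: algebra_simps)
  show "(narayana_fps * (1 - X2 - Z2)) $ n = (1 + X2 * (Z2 * narayana_fps\<^sup>2)) $ n"
  proof (cases n)
    case 0
    then show ?thesis
      unfolding split using inverse_one_minus_fps_X by (simp add: narayana_fps_def algebra_simps)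
  next
    case (Suc k)
    define S where "S = narayana_coeff k
      + fps_X * (\<Sum>i=0..k. narayana_coeff i * narayana_coeff (k - i))"
    have "(narayana_fps * (1 - X2 - Z2)) $ n
      = inverse (1 - fps_X) * (1 - fps_X) * S - narayana_coeff k"
      unfolding split Suc S_def by (simp add: narayana_fps_def algebra_simps)
    also have "\<dots> = fps_X * (\<Sum>i=0..k. narayana_coeff i * narayana_coeff (k - i))"
      unfolding inverse_one_minus_fps_X by (simp add: S_def)
    also have "\<dots> = (1 + X2 * (Z2 * narayana_fps\<^sup>2)) $ n"
    proof -
      have "(narayana_fps * narayana_fps) $ k = (\<Sum>i=0..k. narayana_coeff i * narayana_coeff (k - i))"
        by (simp add: narayana_fps_def fps_mult_nth)
      then show ?thesis
        by (simp add: Suc power2_eq_square)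
    qed
    finally show ?thesis .
  qed
qed

lemma geometric_fps_eq: "geometric_fps * (1 - X2 - Z2) = 1"
proof (rule fps_ext)
  fix n
  have split: "geometric_fps * (1 - X2 - Z2) = geometric_fps - X2 * geometric_fps - Z2 * geometric_fps"
    by (simp add: algebra_simps)
  show "(geometric_fps * (1 - X2 - Z2)) $ n = 1 $ n"
  proof (cases n)
    case 0
    then show ?thesis
      unfolding split using inverse_one_minus_fps_X by (simp add: geometric_fps_def algebra_simps)
  next
    case (Suc k)
    have "(geometric_fps * (1 - X2 - Z2)) $ n
      = (inverse (1 - fps_X) * (1 - fps_X)) * inverse (1 - fps_X) ^ n - inverse (1 - fps_X) ^ n"
      unfolding split Suc by (simp add: geometric_fps_def algebra_simps)
    then show ?thesis
      unfolding inverse_one_minus_fps_X using Suc by simp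
  qed
qed

text \<open>The candidate for V(1^k 2^l 3^m), identified with it in
  \<open>of_nat_V3\<close>.\<close>

definition vertex_coeff :: "nat \<Rightarrow> nat \<Rightarrow> nat \<Rightarrow> rat" where
  "vertex_coeff k l m = (geometric_fps * narayana_fps ^ l) $ k $ m"

lemma vertex_coeff_0:
  "vertex_coeff k 0 m = (if k = 0 \<and> m = 0 then 1 else
     (if k = 0 then 0 else vertex_coeff (k - 1) 0 m) + (if m = 0 then 0 else vertex_coeff k 0 (m - 1)))"
proof -
  have "geometric_fps = 1 + X2 * geometric_fps + Z2 * geometric_fps"
    using geometric_fps_eq by (simp add: algebra_simps)
  then have "geometric_fps $ k $ m = (1 + X2 * geometric_fps + Z2 * geometric_fps) $ k $ m"
    by (rule arg_cong)
  then show ?thesis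
    by (simp add: vertex_coeff_def)
qed

text \<open>The equation of W times W^l gives W^(l+1) (1 - x - z) = W^l + xz W^(l+2); the
  conditionals drop terms with a negative exponent.\<close>

lemma vertex_coeff_Suc:
  "vertex_coeff k (Suc l) m =
     (if k = 0 then 0 else vertex_coeff (k - 1) (Suc l) m) +
     (if m = 0 then 0 else vertex_coeff k (Suc l) (m - 1)) +
     vertex_coeff k l m +
     (if k = 0 \<or> m = 0 then 0 else vertex_coeff (k - 1) (Suc (Suc l)) (m - 1))"
proof -
  let ?g = "\<lambda>l. geometric_fps * narayana_fps ^ l"
  have "?g (Suc l) * (1 - X2 - Z2) = geometric_fps * narayana_fps ^ l * (narayana_fps * (1 - X2 - Z2))"
    by (simp add: algebra_simps)
  also have "\<dots> = ?g l + X2 * (Z2 * ?g (Suc (Suc l)))"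
    unfolding narayana_fps_eq by (simp add: algebra_simps power2_eq_square)
  finally have "?g (Suc l) * (1 - X2 - Z2) = ?g l + X2 * (Z2 * ?g (Suc (Suc l)))" .
  moreover have "g * (1 - X2 - Z2) = g - X2 * g - Z2 * g" for g
    by (simp add: algebra_simps)
  ultimately have "?g (Suc l) = X2 * ?g (Suc l) + Z2 * ?g (Suc l) + ?g l + X2 * (Z2 * ?g (Suc (Suc l)))"
    by (simp only: diff_eq_eq add_ac)
  then have "?g (Suc l) $ k $ m =
      (X2 * ?g (Suc l) + Z2 * ?g (Suc l) + ?g l + X2 * (Z2 * ?g (Suc (Suc l)))) $ k $ m"
    by (rule arg_cong)
  then show ?thesis
    unfolding vertex_coeff_def by (simp del: power_Suc)
qed

text \<open>The inclusion $\mathbb{Q}[[x,z]] \subseteq \mathbb{Q}[[x,y,z]]$.\<close>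

definition embed_xz :: "rat fps fps \<Rightarrow> fps3" where
  "embed_xz f = Abs_fps (\<lambda>k. fps_const (f $ k))"

lemma fps_const_sum: "fps_const (sum f A) = (\<Sum>i\<in>A. fps_const (f i))"
  by (induction A rule: infinite_finite_induct) (auto simp flip: fps_const_add)

lemma embed_xz_add: "embed_xz (f + g) = embed_xz f + embed_xz g"
  by (rule fps_ext) (simp add: embed_xz_def)

lemma embed_xz_diff: "embed_xz (f - g) = embed_xz f - embed_xz g"
  by (rule fps_ext) (simp add: embed_xz_def)

lemma embed_xz_mult: "embed_xz (f * g) = embed_xz f * embed_xz g"
  by (rule fps_ext) (simp add: embed_xz_def fps_mult_nth fps_const_sum)

lemma embed_xz_1: "embed_xz 1 = 1"
  by (rule fps_ext) (simp add: embed_xz_def)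

lemma embed_xz_X2: "embed_xz X2 = var_x"
  by (rule fps_ext) (simp add: embed_xz_def var_x_def fps_X_def)

lemma embed_xz_Z2: "embed_xz Z2 = var_z"
  by (rule fps_ext) (simp add: embed_xz_def var_z_def)

lemmas embed_xz_simps = embed_xz_add embed_xz_diff embed_xz_mult embed_xz_1 embed_xz_X2 embed_xz_Z2

text \<open>A factor free of y does not mix powers of y, so the product can be taken separately at
  each y^l.\<close>

lemma embed_xz_mult_nth: "(embed_xz f * g) $ k $ l = (f * Abs_fps (\<lambda>k. g $ k $ l)) $ k"
  unfolding fps_mult_nth[of _ _ k] fps_sum_nth by (simp add: embed_xz_def)

section \<open>The trivariate series and its closed form\<close>

definition vertex_series :: fps3 where
  "vertex_series = Abs_fps (\<lambda>k. Abs_fps (\<lambda>l. Abs_fps (\<lambda>m. vertex_coeff k l m)))"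

lemma vertex_series_nth: "Abs_fps (\<lambda>k. vertex_series $ k $ l) = geometric_fps * narayana_fps ^ l"
  by (intro fps_ext) (simp add: vertex_series_def vertex_coeff_def)

text \<open>Self-similarity of the geometric series in yW with first term 1/(1 - x - z).\<close>

lemma vertex_series_unfold: "vertex_series = embed_xz geometric_fps + var_y * (embed_xz narayana_fps * vertex_series)"
proof (rule fps_ext, rule fps_ext)
  fix k l
  have nth: "vertex_series $ k $ l = (geometric_fps * narayana_fps ^ l) $ k" for l
    by (intro fps_ext) (simp add: vertex_series_def vertex_coeff_def)
  show "vertex_series $ k $ l = (embed_xz geometric_fps + var_y * (embed_xz narayana_fps * vertex_series)) $ k $ l"
  proof (cases l)
    case 0
    then show ?thesis
      unfolding nth by (simp add: embed_xz_def var_y_def)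
  next
    case (Suc l')
    then show ?thesis
      by (simp add: nth Suc var_y_def embed_xz_mult_nth vertex_series_nth del: power_Suc)
        (simp add: embed_xz_def ac_simps)
  qed
qed

lemma vertex_series_eq:
  "vertex_series * (1 - var_x - var_z) * (1 - var_y * embed_xz narayana_fps) = 1"
proof -
  have "vertex_series * (1 - var_y * embed_xz narayana_fps) = embed_xz geometric_fps"
    using vertex_series_unfold by (simp add: algebra_simps)
  moreover have "embed_xz geometric_fps * (1 - var_x - var_z) = 1"
    using arg_cong[OF geometric_fps_eq, of embed_xz] by (simp add: embed_xz_simps)
  ultimately show ?thesis
    by (metis mult.assoc mult.commute)
qed

lemma embed_xz_narayana_eq: "embed_xz narayana_fps * (1 - var_x - var_z) = 1 + var_x * (var_z * (embed_xz narayana_fps)\<^sup>2)"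
  using arg_cong[OF narayana_fps_eq, of embed_xz] by (simp add: embed_xz_simps power2_eq_square)

text \<open>In an integral domain the only square roots are s and -s; the constant term fixes the
  sign.\<close>

lemma fps3_sqrt_eqI:
  assumes "s\<^sup>2 = f" and "s $ 0 $ 0 $ 0 = 1"
  shows "fps3_sqrt f = s"
  unfolding fps3_sqrt_def
proof (rule the_equality)
  fix t assume t: "t\<^sup>2 = f \<and> t $ 0 $ 0 $ 0 = 1"
  then have "t = s \<or> t = - s"
    using assms(1) by (metis power2_eq_iff)
  then show "t = s"
    using t assms(2) by auto
qed (use assms in simp)

lemma fps3_sqrt_discriminant:
  "fps3_sqrt (1 - 2 * (var_x + var_z) + (var_x - var_z)\<^sup>2)
     = 1 - var_x - var_z - 2 * var_x * var_z * embed_xz narayana_fps"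
proof (rule fps3_sqrt_eqI)
  \<comment> \<open>Grouped so that the last bracket is 1 by the equation of W, leaving (1 - x -
    z)^2 - 4xz.\<close>
  have "(1 - var_x - var_z - 2 * var_x * var_z * embed_xz narayana_fps)\<^sup>2
      = (1 - var_x - var_z)\<^sup>2
        - 4 * var_x * var_z * (embed_xz narayana_fps * (1 - var_x - var_z) - var_x * (var_z * (embed_xz narayana_fps)\<^sup>2))"
    by (simp add: power2_eq_square algebra_simps)
  also have "\<dots> = 1 - 2 * (var_x + var_z) + (var_x - var_z)\<^sup>2"
    unfolding embed_xz_narayana_eq by (simp add: power2_eq_square algebra_simps)
  finally show "(1 - var_x - var_z - 2 * var_x * var_z * embed_xz narayana_fps)\<^sup>2
      = 1 - 2 * (var_x + var_z) + (var_x - var_z)\<^sup>2" .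
qed (simp add: var_x_def var_z_def mult.assoc)

text \<open>Allows division in the fraction field. The witnesses are the constant term of one factor
  and the coefficient of y in the other.\<close>

lemma denominator_nonzero:
  "2 * (1 - var_x - var_z) * ((var_x + var_y) * (var_y + var_z) - var_y) \<noteq> 0"
proof -
  have "(1 - var_x - var_z) $ 0 $ 0 $ 0 = 1"
    by (simp add: var_x_def var_z_def)
  then have "1 - var_x - var_z \<noteq> 0"
    by (metis fps_zero_nth zero_neq_one)
  moreover have "((var_x + var_y) * (var_y + var_z) - var_y) $ 0 $ 1 $ 0 = -1"
    by (simp add: var_x_def var_y_def var_z_def)
  then have "(var_x + var_y) * (var_y + var_z) - var_y \<noteq> 0"
    by (metis fps_zero_nth neg_equal_0_iff_equal zero_neq_one)
  ultimately show ?thesis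
    by (metis mult_eq_0_iff zero_neq_numeral)
qed

text \<open>The last factor of the denominator is the kernel y^2 - (1 - x - z)y + xz. The numerator
  times 1 - yW is twice this kernel, so \<open>vertex_series_eq\<close> finishes.\<close>

lemma vertex_series_closed_form:
  "vertex_series * (2 * (1 - var_x - var_z) * ((var_x + var_y) * (var_y + var_z) - var_y))
    = 2 * var_x * var_z - var_y * (1 - var_x - var_z)
      - var_y * fps3_sqrt (1 - 2 * (var_x + var_z) + (var_x - var_z)\<^sup>2)"
  (is "_ * (2 * ?q * ?d) = ?N")
proof -
  let ?w = "embed_xz narayana_fps"
  have N: "?N = 2 * (var_x * var_z - var_y * ?q + var_x * var_y * var_z * ?w)"
    unfolding fps3_sqrt_discriminant by (simp add: algebra_simps)
  \<comment> \<open>The terms in xyzW cancel, and the bracket after y^2 is 1 by the equation of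
    W.\<close>
  have "?N * (1 - var_y * ?w) = 2 * (var_x * var_z - var_y * ?q
      + var_y\<^sup>2 * (?w * ?q - var_x * (var_z * ?w\<^sup>2)))"
    unfolding N by (simp add: power2_eq_square algebra_simps)
  also have "\<dots> = 2 * ?d"
    unfolding embed_xz_narayana_eq by (simp add: power2_eq_square algebra_simps)
  finally have *: "?N * (1 - var_y * ?w) = 2 * ?d" .
  have "vertex_series * (2 * ?q * ?d) = vertex_series * ?q * (2 * ?d)"
    by (simp only: ac_simps)
  also have "\<dots> = (vertex_series * ?q * (1 - var_y * ?w)) * ?N"
    unfolding *[symmetric] by (simp only: ac_simps)
  finally show ?thesis
    unfolding vertex_series_eq by simp
qed

section \<open>Recurrences for V(1^k 2^l 3^m)\<close>

lemma first_rows_replicate: "first_rows (replicate (Suc n) a) = {replicate n a}"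
  by (induction n) auto

text \<open>Neighbours inside the run offer only \<open>a\<close>; a choice arises where the run
  meets \<open>b\<close>.\<close>

lemma first_rows_replicate_append:
  "first_rows (replicate (Suc n) a @ b # r) =
     (\<Union>q\<in>first_rows (b # r). {replicate n a @ a # q, replicate n a @ b # q})"
  by (induction n) auto

definition V3 :: "nat \<Rightarrow> nat \<Rightarrow> nat \<Rightarrow> nat" where
  "V3 k l m = gz_vertex_count (replicate k 1 @ replicate l 2 @ replicate m 3)"

lemma sorted_replicate_123:
  "sorted (replicate k (1::int) @ replicate l 2 @ replicate m 3)"
  by (auto simp: sorted_append)

lemma V3_eq_sum:
  assumes "k + l + m \<noteq> 0"
  shows "V3 k l m = (\<Sum>q\<in>first_rows (replicate k 1 @ replicate l 2 @ replicate m 3). gz_vertex_count q)"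
  unfolding V3_def using assms by (intro gz_vertex_count_rec sorted_replicate_123) auto

text \<open>The choice at the single border decides which of the two runs loses a letter.\<close>

lemma V3_two_letters:
  "V3 (Suc k) (Suc l) 0 = V3 (Suc k) l 0 + V3 k (Suc l) 0"
  "V3 (Suc k) 0 (Suc m) = V3 (Suc k) 0 m + V3 k 0 (Suc m)"
  "V3 0 (Suc l) (Suc m) = V3 0 (Suc l) m + V3 0 l (Suc m)"
proof -
  have aux: "(\<Sum>q\<in>first_rows (replicate (Suc k) a @ replicate (Suc l) b). gz_vertex_count q) =
      gz_vertex_count (replicate (Suc k) a @ replicate l b) +
      gz_vertex_count (replicate k a @ replicate (Suc l) b)" if "a \<noteq> b" for k l a b
  proof -
    have "first_rows (replicate (Suc k) a @ replicate (Suc l) b) =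
        {replicate k a @ a # replicate l b, replicate k a @ b # replicate l b}"
      using first_rows_replicate_append[of k a b "replicate l b"] first_rows_replicate[of l b]
      by simp
    moreover have "replicate k a @ a # replicate l b \<noteq> replicate k a @ b # replicate l b"
      using that by simp
    ultimately show ?thesis
      by (simp add: replicate_app_Cons_same)
  qed
  show "V3 (Suc k) (Suc l) 0 = V3 (Suc k) l 0 + V3 k (Suc l) 0"
    "V3 (Suc k) 0 (Suc m) = V3 (Suc k) 0 m + V3 k 0 (Suc m)"
    "V3 0 (Suc l) (Suc m) = V3 0 (Suc l) m + V3 0 l (Suc m)"
    by (subst V3_eq_sum, simp, use aux[of 1 2 k l] aux[of 1 3 k m] aux[of 2 3 l m] in \<open>simp add: V3_def\<close>)+
qed

lemma V3_one_letter: "V3 k 0 0 = 1" "V3 0 l 0 = 1" "V3 0 0 m = 1"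
proof -
  have "gz_vertex_count (replicate n a) = 1" for n a
  proof (induction n)
    case (Suc n)
    then show ?case
      using gz_vertex_count_rec[of "replicate (Suc n) a"] first_rows_replicate[of n a] by simp
  qed (simp add: gz_vertex_count_Nil)
  then show "V3 k 0 0 = 1" "V3 0 l 0 = 1" "V3 0 0 m = 1"
    by (simp_all add: V3_def)
qed

text \<open>With a 2 present, the borders between 1 and 2 and between 2 and 3 are independent, which
  gives four first rows.\<close>

lemma V3_three_letters:
  "V3 (Suc k) (Suc l) (Suc m) =
     V3 (Suc k) (Suc l) m + V3 (Suc k) l (Suc m) + V3 k (Suc (Suc l)) m + V3 k (Suc l) (Suc m)"
proof -
  let ?p = "replicate (Suc k) 1 @ replicate (Suc l) 2 @ replicate (Suc m) 3 :: int list"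
  let ?q = "\<lambda>c d. replicate k 1 @ c # replicate l 2 @ d # replicate m 3 :: int list"
  have "first_rows ?p = {?q 1 2, ?q 2 2, ?q 1 3, ?q 2 3}"
  proof -
    have "first_rows (2 # replicate l 2 @ 3 # replicate m 3) =
        {replicate l 2 @ 2 # replicate m 3, replicate l 2 @ 3 # replicate m (3::int)}"
      using first_rows_replicate_append[of l 2 3 "replicate m (3::int)"]
        first_rows_replicate[of m "3::int"] by simp
    then show ?thesis
      using first_rows_replicate_append[of k 1 2 "replicate l 2 @ 3 # replicate m (3::int)"]
      by (simp add: replicate_Suc insert_commute)
  qed
  moreover have "?q c d = ?q c' d' \<longleftrightarrow> c = c' \<and> d = d'" for c d c' d'
    by simp
  ultimately have "V3 (Suc k) (Suc l) (Suc m) = gz_vertex_count (?q 1 2) + gz_vertex_count (?q 2 2)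
      + gz_vertex_count (?q 1 3) + gz_vertex_count (?q 2 3)"
    by (subst V3_eq_sum) (simp_all del: replicate_Suc)
  then show ?thesis
    by (simp add: V3_def replicate_app_Cons_same)
qed

text \<open>All recurrences lower k + l + m by one. On the boundary the missing terms of
  \<open>vertex_coeff_Suc\<close> are exactly those absent from the recurrences with fewer
  letters.\<close>

lemma of_nat_V3: "of_nat (V3 k l m) = vertex_coeff k l m"
proof (induction "k + l + m" arbitrary: k l m rule: less_induct)
  case less
  show ?case
  proof (cases l)
    case 0
    show ?thesis
    proof (cases "k = 0 \<or> m = 0")
      case True
      \<comment> \<open>Away from the origin just one term of Pascal's rule survives here, and it is
        1 by induction.\<close>
      have "vertex_coeff k 0 m = 1"
      proof (cases "k = 0 \<and> m = 0")
        case False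
        then show ?thesis
          using True less[of "k - 1" 0 m] less[of k 0 "m - 1"] 0
          by (subst vertex_coeff_0) (auto simp: V3_one_letter)
      qed (simp add: vertex_coeff_0)
      then show ?thesis
        using 0 True by (auto simp: V3_one_letter)
    next
      case False
      then obtain k' m' where km: "k = Suc k'" "m = Suc m'"
        by (meson not0_implies_Suc)
      then show ?thesis
        using less[of k' 0 m] less[of k 0 m'] 0
        by (simp add: V3_two_letters vertex_coeff_0[of "Suc k'" "Suc m'"])
    qed
  next
    case (Suc l')
    note rec = vertex_coeff_Suc[of k l' m, folded Suc]
    show ?thesis
    proof (cases k)
      case k: 0
      show ?thesis
      proof (cases m)
        case 0
        then show ?thesis
          using rec less[of k l' m] k Suc by (simp add: V3_one_letter)
      next
        case (Suc m')
        then show ?thesis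
          using rec less[of k l' m] less[of k l m'] k \<open>l = Suc l'\<close> by (simp add: V3_two_letters)
      qed
    next
      case k: (Suc k')
      show ?thesis
      proof (cases m)
        case 0
        then show ?thesis
          using rec less[of k l' m] less[of k' l m] k Suc by (simp add: V3_two_letters)
      next
        case (Suc m')
        then show ?thesis
          using rec less[of k l' m] less[of k' l m] less[of k l m'] less[of k' "Suc l" m'] k
            \<open>l = Suc l'\<close> by (simp add: V3_three_letters)
      qed
    qed
  qed
qed

lemma G3_eq_vertex_series: "G3 = vertex_series"
  unfolding G3_def vertex_series_def by (simp add: of_nat_V3 flip: V3_def)


theorem theorem1p3:
  "to_fract G3 =
    to_fract (2 * var_x * var_z - var_y * (1 - var_x - var_z)
      - var_y * fps3_sqrt (1 - 2 * (var_x + var_z) + (var_x - var_z) ^ 2)) /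
    to_fract (2 * (1 - var_x - var_z) * ((var_x + var_y) * (var_y + var_z) - var_y))"
  using vertex_series_closed_form denominator_nonzero
  unfolding G3_eq_vertex_series
  by (metis nonzero_eq_divide_eq to_fract_eq_0_iff to_fract_mult)

end
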